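(* Let $D\subset\mathbb{R}^2$ be the closed union of finitely many static obstacles. Let $d_{sfe}>0$ be the required safety margin, $v_{max}>0$ the maximal vehicle speed, and $d_{trk}\ge 0$ an upper bound on the tracking deviation (see context). Put $d_{tar}:=d_{sfe}+\frac{v_{max}}{2}+d_{trk}$. Suppose the probational trajectory adopted for use by the vehicle at time step $k-1$ is feasible, i.e. the distance from each of its way-points to $D$ exceeds $d_{tar}$. Then, whatever the external disturbances, the vehicle does not collide with the obstacles on the time interval $[k-1,k]$, and respects the required safety margin: the distance from the actual vehicle position $s(t)$ to $D$ exceeds $d_{sfe}$ for all $t\in[k-1,k]$.
   Context: The time step is normalized to $1$; $k$ is an integer time index. A vehicle moves in the plane among static obstacles (closed sets) with union $D$. A probational trajectory is a nominal (disturbance-free) planned motion, specified by its way-points, i.e. its planned positions at integer times. The trajectory adopted for use at step $k-1$ has in particular way-points for times $k-1$ and $k$. Between integer times it is interpolated according to the nominal vehicle model, and its speed never exceeds $v_{max}$. The actual vehicle is subject to disturbances and is driven along the adopted probational trajectory by a trajectory tracking module. The constant $d_{trk}$ is an upper bound on the translational deviation, over the planning horizon, between the probational trajectory and the real motion of the vehicle driven along it under any admissible disturbance: $\|s(t)-s^*(t)\|\le d_{trk}$, where $s(t)$ is the actual position and $s^*(t)$ the nominal position on the probational trajectory at time $t$. The vehicle "respects the safety margin" if its distance to every obstacle exceeds $d_{sfe}$. *)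

theory Defs
  imports "HOL-Analysis.Analysis"
begin

(* Extended-real valued, so that the distance to the empty set is infinite; infdist would
   make it 0, and every trajectory would count as unsafe when there are no obstacles. *)
definition obst_dist :: "'a::metric_space \<Rightarrow> 'a set \<Rightarrow> ereal" where
  "obst_dist x D = (INF y\<in>D. ereal (dist x y))"

definition horizon :: "int \<Rightarrow> int \<Rightarrow> real set" where
  "horizon m n = {of_int m..of_int n}"

definition way_points :: "(real \<Rightarrow> 'a) \<Rightarrow> int \<Rightarrow> int \<Rightarrow> 'a set" where
  "way_points p m n = (\<lambda>j. p (of_int j)) ` {m..n}"

(* The velocity V is taken in the integral (Caratheodory) sense, because a planned control
   input, and hence the planned velocity, may be discontinuous. *)
definition has_velocity_on ::
  "(real \<Rightarrow> 'a::euclidean_space) \<Rightarrow> (real \<Rightarrow> 'a) \<Rightarrow> real set \<Rightarrow> bool" where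
  "has_velocity_on p V T \<longleftrightarrow>
     (\<forall>t1\<in>T. \<forall>t2\<in>T. t1 \<le> t2 \<longrightarrow> (V has_integral (p t2 - p t1)) {t1..t2})"

definition speed_bounded_on ::
  "real \<Rightarrow> (real \<Rightarrow> 'a::euclidean_space) \<Rightarrow> real set \<Rightarrow> bool" where
  "speed_bounded_on v p T \<longleftrightarrow> (\<exists>V. has_velocity_on p V T \<and> (\<forall>t\<in>T. norm (V t) \<le> v))"

definition feasible :: "real \<Rightarrow> 'a::metric_space set \<Rightarrow> (real \<Rightarrow> 'a) \<Rightarrow> int \<Rightarrow> int \<Rightarrow> bool" where
  "feasible d D p m n \<longleftrightarrow> (\<forall>x\<in>way_points p m n. obst_dist x D > ereal d)"

(* W is the set of admissible disturbances; r w is the real motion, under disturbance w, of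
   the vehicle driven along the planned motion p. *)
definition tracks_within ::
  "real \<Rightarrow> 'w set \<Rightarrow> ('w \<Rightarrow> real \<Rightarrow> 'a::real_normed_vector) \<Rightarrow> (real \<Rightarrow> 'a) \<Rightarrow> real set \<Rightarrow> bool" where
  "tracks_within d W r p T \<longleftrightarrow> (\<forall>w\<in>W. \<forall>t\<in>T. norm (r w t - p t) \<le> d)"

lemma obst_dist_eq_infdist:
  assumes "D \<noteq> {}"
  shows "obst_dist x D = ereal (infdist x D)"
proof -
  have bdd: "bdd_below (dist x ` D)"
    by (auto intro!: bdd_belowI[where m=0])
  show ?thesis
    unfolding obst_dist_def
  proof (rule antisym)
    show "(INF y\<in>D. ereal (dist x y)) \<le> ereal (infdist x D)"
    proof (rule ereal_le_epsilon2)
      fix e :: real assume "e > 0"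
      then have "infdist x D < infdist x D + e" by simp
      then obtain y where "y \<in> D" "dist x y < infdist x D + e"
        using assms bdd cINF_less_iff[of D "dist x"] infdist_notempty[of D x] by metis
      then show "(INF y\<in>D. ereal (dist x y)) \<le> ereal (infdist x D) + ereal e"
        by (auto intro!: INF_lower2[of y])
    qed
    show "ereal (infdist x D) \<le> (INF y\<in>D. ereal (dist x y))"
      by (auto intro!: INF_greatest infdist_le)
  qed
qed

(* Classical motions are covered: continuous, and differentiable outside a finite set of
   times, with velocity V there. *)
lemma has_velocity_on_classical:
  fixes p V :: "real \<Rightarrow> 'a::euclidean_space"
  assumes "finite S" "continuous_on {a..b} p"
    and "\<And>t. t \<in> {a..b} - S \<Longrightarrow> (p has_vector_derivative V t) (at t)"
  shows "has_velocity_on p V {a..b}"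
  unfolding has_velocity_on_def
proof (intro ballI impI)
  fix t1 t2 assume t: "t1 \<in> {a..b}" "t2 \<in> {a..b}" "t1 \<le> t2"
  then have sub: "{t1..t2} \<subseteq> {a..b}" by auto
  show "(V has_integral (p t2 - p t1)) {t1..t2}"
  proof (rule fundamental_theorem_of_calculus_strong[OF assms(1) t(3)])
    show "continuous_on {t1..t2} p"
      using assms(2) sub by (rule continuous_on_subset)
    fix t assume "t \<in> {t1..t2} - S"
    then show "(p has_vector_derivative V t) (at t)"
      using assms(3)[of t] sub by blast
  qed
qed

end

theory Submission
  imports Defs
begin

(* Every time in [k-1, k] lies within 1/2 of k-1 or of k, so the planned position lies within
   v_max/2 of a way-point, and the actual position within v_max/2 + d_trk of it. *)

text \<open>The distance to \<open>D\<close> is 1-Lipschitz, so moving from a way-point to the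
  actual position costs at most the length of the move. The summands of \<open>d_tar\<close> budget
  for this: \<open>v_max / 2\<close> pays for the planned motion away from the nearest way-point
  (\<open>speed_bounded_on_dist_le\<close>), \<open>d_trk\<close> pays for the tracking error, and
  \<open>d_sfe\<close> is what remains (\<open>obst_dist_greater_if_dist_le\<close>). A positive
  remainder excludes collision.\<close>

lemma speed_bounded_on_dist_le:
  assumes "speed_bounded_on v p {a..b}" and t: "t1 \<in> {a..b}" "t2 \<in> {a..b}"
  shows "dist (p t1) (p t2) \<le> v * dist t1 t2"
proof -
  obtain V where V: "has_velocity_on p V {a..b}"
    and bound: "\<And>t. t \<in> {a..b} \<Longrightarrow> norm (V t) \<le> v"
    using assms(1) unfolding speed_bounded_on_def by blast
  have "0 \<le> v"
    using bound[OF t(1)] norm_ge_zero order_trans by blast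
  \<comment> \<open>The increment of \<open>p\<close> is the integral of \<open>V\<close>, hence at
    most \<open>v\<close> times the length of the interval. \<open>has_velocity_on\<close> only
    covers ordered times; symmetry of \<open>dist\<close> gives the other order.\<close>
  have ordered: "dist (p u1) (p u2) \<le> v * dist u1 u2"
    if u: "u1 \<in> {a..b}" "u2 \<in> {a..b}" "u1 \<le> u2" for u1 u2
  proof -
    have "(V has_integral (p u2 - p u1)) {u1..u2}"
      using V u unfolding has_velocity_on_def by blast
    then have "norm (p u2 - p u1) \<le> v * measure lborel {u1..u2}"
      using u bound by (intro has_integral_bound_real[OF \<open>0 \<le> v\<close>, of "{}"]) auto
    then show ?thesis
      using u(3) by (simp add: dist_norm norm_minus_commute)
  qed
  show ?thesis
    using t ordered[of t1 t2] ordered[of t2 t1] by (simp add: dist_commute) linarith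
qed

text \<open>This is the triangle inequality for the distance to a set, with strictness
  preserved.\<close>

lemma obst_dist_greater_if_dist_le:
  assumes far: "obst_dist y D > ereal (d + e)" and near: "dist x y \<le> e"
  shows "obst_dist x D > ereal d"
proof (cases "D = {}")
  \<comment> \<open>The infimum over the empty set is infinite.\<close>
  case True
  then show ?thesis by (simp add: obst_dist_def top_ereal_def)
next
  case False
  then show ?thesis
    using assms infdist_triangle[of y D x]
    by (simp add: obst_dist_eq_infdist dist_commute)
qed

lemma not_in_obstacle_if_obst_dist_pos:
  assumes "obst_dist x D > 0"
  shows "x \<notin> D"
proof
  assume "x \<in> D"
  then have "obst_dist x D \<le> ereal (dist x x)"
    unfolding obst_dist_def by (rule INF_lower)
  with assms show False by (simp add: zero_ereal_def)
qed

theorem lemma3p2p1: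
  fixes Obs :: "(real ^ 2) set set" and D :: "(real ^ 2) set"
    and d_sfe v_max d_trk d_tar :: real
    and k m n :: int
    and p :: "real \<Rightarrow> real ^ 2"
    and W :: "'w set"
    and r s :: "'w \<Rightarrow> real \<Rightarrow> real ^ 2"
  assumes obstacles: "finite Obs" "\<And>Q. Q \<in> Obs \<Longrightarrow> closed Q" "D = \<Union> Obs"
    and "d_sfe > 0" and "v_max > 0" and "d_trk \<ge> 0"
    and d_tar: "d_tar = d_sfe + v_max / 2 + d_trk"
    and "m \<le> k - 1" and "k \<le> n"
    and speed: "speed_bounded_on v_max p (horizon m n)"
    and tracking: "tracks_within d_trk W r p (horizon m n)"
    and adopted: "\<And>w t. w \<in> W \<Longrightarrow> t \<in> horizon (k - 1) k \<Longrightarrow> s w t = r w t"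
    and feasible: "feasible d_tar D p m n"
  shows "\<forall>w\<in>W. \<forall>t\<in>horizon (k - 1) k. s w t \<notin> D \<and> obst_dist (s w t) D > ereal d_sfe"
proof (intro ballI)
  fix w t assume w: "w \<in> W" and t: "t \<in> horizon (k - 1) k"
  \<comment> \<open>The integer time nearest to \<open>t\<close>; at the midpoint either end would
    do.\<close>
  define j where "j = (if t \<le> of_int k - 1 / 2 then k - 1 else k)"
  have j: "j \<in> {m..n}"
    using \<open>m \<le> k - 1\<close> \<open>k \<le> n\<close> by (simp add: j_def)
  then have j': "of_int j \<in> {real_of_int m..of_int n}" by simp
  have "real_of_int m \<le> of_int (k - 1)" "real_of_int k \<le> of_int n"
    using \<open>m \<le> k - 1\<close> \<open>k \<le> n\<close> by (simp_all only: of_int_le_iff)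
  then have t': "t \<in> {real_of_int m..of_int n}"
    using t by (simp add: horizon_def)
  have "dist t (of_int j) \<le> 1 / 2"
    using t by (auto simp: j_def horizon_def dist_real_def)
  then have "v_max * dist t (of_int j) \<le> v_max / 2"
    using mult_left_mono[of "dist t (of_int j)" "1 / 2" v_max] \<open>v_max > 0\<close> by simp
  moreover have "dist (p t) (p (of_int j)) \<le> v_max * dist t (of_int j)"
    using speed t' j' unfolding horizon_def by (rule speed_bounded_on_dist_le)
  moreover have "dist (s w t) (p t) \<le> d_trk"
    using tracking w t' adopted[OF w t]
    by (simp add: tracks_within_def horizon_def dist_norm)
  ultimately have "dist (s w t) (p (of_int j)) \<le> v_max / 2 + d_trk"
    using dist_triangle[of "s w t" "p (of_int j)" "p t"] by linarith
  \<comment> \<open>\<open>d_tar\<close> is regrouped as the margin to keep plus the total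
    displacement.\<close>
  moreover have "obst_dist (p (of_int j)) D > ereal (d_sfe + (v_max / 2 + d_trk))"
    using feasible j by (simp add: feasible_def way_points_def d_tar add.assoc)
  ultimately have safe: "obst_dist (s w t) D > ereal d_sfe"
    by (rule obst_dist_greater_if_dist_le[rotated])
  have "0 < ereal d_sfe"
    using \<open>d_sfe > 0\<close> by simp
  then have "s w t \<notin> D"
    using safe by (intro not_in_obstacle_if_obst_dist_pos) (rule less_trans)
  with safe show "s w t \<notin> D \<and> obst_dist (s w t) D > ereal d_sfe" by blast
qed

end
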